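(* Let $f\in L^{\infty}_{\mathrm{loc}}(\mathbb{R})$ be measurable, periodic with period $1$, with $f(t)>0$ for a.e. $t$, and consider the Perfect Integrator model $\dot{x}=f(t)$ with firing map $\Phi$. If $\int_0^1 f(u)\,du=q/p\in\mathbb{Q}$ (with $p,q$ positive integers), then for every $t\in\mathbb{R}$ the sequence of interspike-intervals $\mathrm{ISI}_n(t)$, $n\ge 1$, is periodic with period $q$, i.e. $\mathrm{ISI}_{n+q}(t)=\mathrm{ISI}_n(t)$ for all $n\ge1$.
   Context: Periodic with period $1$ means $f(t+1)=f(t)$ for a.e. $t$. The firing map of $\dot{x}=f(t)$ (reset value $0$, threshold $1$) is $\Phi(t):=\inf\{t_*>t:\ 1\le\int_t^{t_*}f(u)\,du\}$. The interspike-intervals of the run started at $(t,0)$ are $\mathrm{ISI}_n(t)=\Phi^n(t)-\Phi^{n-1}(t)$, where $\Phi^n$ is the $n$-th iterate. *)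

theory Defs
  imports "HOL-Analysis.Analysis"
begin

text \<open>Functions are honest functions rather than classes modulo null sets; \<open>lebesgue\<close> is
  Lebesgue measure on the completed sigma-algebra.\<close>

definition Linfty_loc :: "(real \<Rightarrow> real) \<Rightarrow> bool" where
  "Linfty_loc f \<longleftrightarrow> f \<in> borel_measurable lebesgue \<and>
     (\<forall>K. compact K \<longrightarrow> (\<exists>C. AE t in lebesgue. t \<in> K \<longrightarrow> \<bar>f t\<bar> \<le> C))"

definition periodic1_ae :: "(real \<Rightarrow> real) \<Rightarrow> bool" where
  "periodic1_ae f \<longleftrightarrow> (AE t in lebesgue. f (t + 1) = f t)"

text \<open>Only meaningful when the set of admissible \<open>s\<close> is nonempty: \<open>Inf {}\<close> is unspecified on
  the reals. For \<open>f\<close> in \<open>Linfty_loc\<close>, 1-periodic and positive almost everywhere it is nonempty,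
  and the Bochner integrals over bounded intervals exist.\<close>

definition firing_map :: "(real \<Rightarrow> real) \<Rightarrow> real \<Rightarrow> real" where
  "firing_map f t = Inf {s. t < s \<and> 1 \<le> (LINT u:{t..s}|lebesgue. f u)}"

text \<open>Used for \<open>n \<ge> 1\<close> only; \<open>ISI f 0 t\<close> has no meaning, as subtraction on \<open>nat\<close> truncates.\<close>

definition ISI :: "(real \<Rightarrow> real) \<Rightarrow> nat \<Rightarrow> real \<Rightarrow> real" where
  "ISI f n t = (firing_map f ^^ n) t - (firing_map f ^^ (n - 1)) t"

end

theory Submission imports Defs begin

text \<open>With \<open>A a b\<close> the integral of \<open>f\<close> over \<open>[a, b]\<close>, the firing map sends \<open>t\<close> to the unique \<open>s > t\<close>
  with \<open>A t s = 1\<close>, so the \<open>n\<close>-th iterate is the unique \<open>s\<close> with \<open>A t s = n\<close>. By periodicity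
  \<open>A t (t + p) = p * (q / p) = q\<close>, hence the \<open>q\<close>-th iterate is the translation by \<open>p\<close>, for every
  starting point; applied at the points of an orbit this gives the claim.\<close>

locale positive_periodic_input =
  fixes f :: "real \<Rightarrow> real"
  assumes Linfty_loc: "Linfty_loc f"
    and periodic: "periodic1_ae f"
    and AE_pos: "AE t in lebesgue. f t > 0"
begin

text \<open>For \<open>b < a\<close> the interval is empty and \<open>A a b\<close> is 0 rather than
  \<open>- A b a\<close>, so additivity and comparison need ordered endpoints.\<close>

definition A :: "real \<Rightarrow> real \<Rightarrow> real" where
  "A a b = (LINT u:{a..b}|lebesgue. f u)"

text \<open>The essential bound of \<open>f\<close> on the compact interval gives a constant
  multiple of the indicator as integrable majorant.\<close>

lemma set_integrable_Icc: "set_integrable lebesgue {a..b} f"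
proof -
  obtain C where C: "AE t in lebesgue. t \<in> {a..b} \<longrightarrow> \<bar>f t\<bar> \<le> C"
    using Linfty_loc compact_Icc unfolding Linfty_loc_def by blast
  have f: "f \<in> borel_measurable lebesgue"
    using Linfty_loc by (simp add: Linfty_loc_def)
  have "integrable lebesgue (\<lambda>t. indicator {a..b} t * C)"
    by (intro integrable_mult_left) (simp add: emeasure_lborel_Icc_eq)
  then show ?thesis
    unfolding set_integrable_def
  proof (rule Bochner_Integration.integrable_bound)
    show "(\<lambda>x. indicator {a..b} x *\<^sub>R f x) \<in> borel_measurable lebesgue"
      by (intro borel_measurable_scaleR borel_measurable_indicator f) simp
  qed (use C in \<open>auto elim!: eventually_mono simp: indicator_def\<close>)
qed

text \<open>Gives access to the Henstock-Kurzweil rules for splitting, shifting, changes on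
  negligible sets and continuity in the endpoint.\<close>

lemma A_eq_integral: "A a b = integral {a..b} f"
  unfolding A_def by (rule set_lebesgue_integral_eq_integral(2)[OF set_integrable_Icc])

lemma integrable_on_Icc: "f integrable_on {a..b}"
  by (rule set_lebesgue_integral_eq_integral(1)[OF set_integrable_Icc])

lemma A_add: "a \<le> b \<Longrightarrow> b \<le> c \<Longrightarrow> A a b + A b c = A a c"
  by (simp add: A_eq_integral integrable_on_Icc Henstock_Kurzweil_Integration.integral_combine)

text \<open>A nonnegative integrand with integral 0 vanishes almost everywhere; as \<open>f\<close>
  is positive almost everywhere, \<open>{a..b}\<close> would then be a null set.\<close>

lemma A_pos:
  assumes "a < b"
  shows "0 < A a b"
proof -
  let ?g = "\<lambda>x. indicator {a..b} x *\<^sub>R f x"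
  have int: "integrable lebesgue ?g"
    using set_integrable_Icc by (simp add: set_integrable_def)
  have nonneg: "AE x in lebesgue. 0 \<le> ?g x"
    using AE_pos by eventually_elim (auto simp: indicator_def)
  have "A a b \<noteq> 0"
  proof
    assume "A a b = 0"
    then have "AE x in lebesgue. ?g x = 0"
      using integral_nonneg_eq_0_iff_AE[OF int nonneg]
      by (simp add: A_def set_lebesgue_integral_def)
    with AE_pos have "AE x in lebesgue. x \<notin> {a..b}"
      by eventually_elim (auto simp: indicator_def)
    then have "emeasure lebesgue {a..b} = 0"
      by (subst (asm) AE_iff_measurable[where N="{a..b}"]) auto
    with assms show False by simp
  qed
  moreover have "0 \<le> A a b"
    using integral_nonneg_AE[OF nonneg] by (simp add: A_def set_lebesgue_integral_def)
  ultimately show ?thesis by simp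
qed

lemma A_self: "A a a = 0"
  by (simp add: A_eq_integral)

lemma A_strict_mono: "t \<le> a \<Longrightarrow> a < b \<Longrightarrow> A t a < A t b"
  using A_add[of t a b] A_pos[of a b] by simp

lemma A_less_iff: "t \<le> a \<Longrightarrow> t \<le> b \<Longrightarrow> A t a < A t b \<longleftrightarrow> a < b"
  using A_strict_mono[of t a b] A_strict_mono[of t b a] by (cases a b rule: linorder_cases) auto

lemma A_eq_iff: "t \<le> a \<Longrightarrow> t \<le> b \<Longrightarrow> A t a = A t b \<longleftrightarrow> a = b"
  using A_less_iff[of t a b] A_less_iff[of t b a] by (cases a b rule: linorder_cases) auto

lemma A_translate: "A (a + 1) (b + 1) = A a b"
proof -
  obtain N where N: "negligible N" "\<And>t. t \<notin> N \<Longrightarrow> f (t + 1) = f t"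
    using periodic unfolding periodic1_ae_def eventually_ae_filter_negligible by blast
  have "integral {a + 1..b + 1} f = integral {a..b} (\<lambda>x. f (x + 1))"
    using integral_shift_Icc_real[of a b f 1] by (simp add: o_def add.commute)
  also have "\<dots> = integral {a..b} f"
    by (rule integral_spike[OF N(1)]) (use N(2) in auto)
  finally show ?thesis
    by (simp add: A_eq_integral)
qed

lemma A_period: "A t (t + 1) = A 0 1"
proof -
  \<comment> \<open>Split \<open>A a (b + 1)\<close> at \<open>b\<close> and at
    \<open>a + 1\<close>, then cancel \<open>A a b\<close> against the equal
    \<open>A (a + 1) (b + 1)\<close>.\<close>
  have "A a (a + 1) = A b (b + 1)" if "a \<le> b" for a b
    using that A_add[of a b "b + 1"] A_add[of a "a + 1" "b + 1"] A_translate[of a b] by simp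
  from this[of t 0] this[of 0 t] show ?thesis
    by (cases "t \<le> 0") auto
qed

lemma A_periods: "A t (t + real k) = real k * A 0 1"
proof (induction k)
  case (Suc k)
  then show ?case
    using A_add[of t "t + real k" "t + real k + 1"] A_period[of "t + real k"]
    by (simp add: algebra_simps)
qed (simp add: A_self)

text \<open>By strict monotonicity the set under the infimum is exactly \<open>{s..}\<close>, so the
  infimum is attained at \<open>s\<close>.\<close>

lemma firing_map_eq:
  assumes "t < s" "A t s = 1"
  shows "firing_map f t = s"
proof -
  have "{s'. t < s' \<and> 1 \<le> A t s'} = {s..}"
  proof (intro set_eqI)
    fix s'
    show "s' \<in> {s'. t < s' \<and> 1 \<le> A t s'} \<longleftrightarrow> s' \<in> {s..}"
      using assms A_less_iff[of t s' s] by auto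
  qed
  then show ?thesis
    by (simp add: firing_map_def flip: A_def)
qed

lemma ex_A_eq_1: "\<exists>s>t. A t s = 1"
proof -
  \<comment> \<open>After \<open>k\<close> periods the integral exceeds 1, so the intermediate value
    theorem applies on \<open>{t..t + real k}\<close>.\<close>
  obtain k where k: "1 < real k * A 0 1"
    using reals_Archimedean3[OF A_pos[of 0 1]] by auto
  have "continuous_on {t..t + real k} (A t)"
    unfolding A_eq_integral by (rule indefinite_integral_continuous_1[OF integrable_on_Icc])
  then obtain s where s: "t \<le> s" "A t s = 1"
    using IVT'[of "A t" t 1 "t + real k"] k A_periods[of t k] by (auto simp: A_self)
  then have "s \<noteq> t" by (auto simp: A_self)
  with s show ?thesis by force
qed

lemma firing_map: "t < firing_map f t" "A t (firing_map f t) = 1"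
  using ex_A_eq_1[of t] firing_map_eq[of t] by auto

text \<open>Each firing adds exactly 1 to the integral accumulated since \<open>t\<close>.\<close>

lemma firing_map_funpow:
  "t \<le> (firing_map f ^^ n) t \<and> A t ((firing_map f ^^ n) t) = real n"
proof (induction n)
  case (Suc n)
  then show ?case
    using firing_map[of "(firing_map f ^^ n) t"]
      A_add[of t "(firing_map f ^^ n) t" "firing_map f ((firing_map f ^^ n) t)"]
    by simp
qed (simp add: A_self)

text \<open>Both points lie at or after \<open>t\<close> and accumulate the integral
  \<open>q\<close> from \<open>t\<close>, so injectivity of \<open>A t\<close> there identifies
  them.\<close>

lemma firing_map_funpow_rational:
  assumes "p > 0" "A 0 1 = real q / real p"
  shows "(firing_map f ^^ q) t = t + real p"
  using firing_map_funpow[where n = q and t = t] A_periods[of t p] assms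
    A_eq_iff[of t "(firing_map f ^^ q) t" "t + real p"]
  by simp

end

theorem proposition3p6:
  fixes f :: "real \<Rightarrow> real" and p q :: nat
  assumes "Linfty_loc f"
    and "periodic1_ae f"
    and "AE t in lebesgue. f t > 0"
    and "p > 0" and "q > 0"
    and "(LINT u:{0..1}|lebesgue. f u) = real q / real p"
  shows "\<forall>t. \<forall>n\<ge>1. ISI f (n + q) t = ISI f n t"
proof (intro allI impI)
  fix t :: real and n :: nat
  assume n: "n \<ge> 1"
  interpret positive_periodic_input f
    using assms by unfold_locales
  \<comment> \<open>The translation by \<open>p\<close> is applied at the orbit point reached after
    \<open>m\<close> firings; it cancels in the difference of consecutive iterates.\<close>
  have shift: "(firing_map f ^^ (q + m)) t = (firing_map f ^^ m) t + real p" for m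
    using firing_map_funpow_rational[of p q "(firing_map f ^^ m) t"] assms
    by (simp add: A_def funpow_add)
  \<comment> \<open>Truncated subtraction makes \<open>n \<ge> 1\<close> essential here.\<close>
  have "n + q - 1 = q + (n - 1)"
    using n by simp
  then show "ISI f (n + q) t = ISI f n t"
    using shift[of n] shift[of "n - 1"] by (simp add: ISI_def add.commute)
qed

end
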